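(* There exists a positive semidefinite polynomial $f\in\mathbb{R}[x,y,z]$ that has a bad point $p\in\mathbb{C}^3$ with $p\notin\mathbb{R}^3$.
   Context: A polynomial $f\in\mathbb{R}[x_1,\dots,x_n]$ is positive semidefinite if $f(a)\geq 0$ for all $a\in\mathbb{R}^n$. A bad point of such an $f$ is a point $p\in\mathbb{C}^n$ such that, in every representation $f=\sum_i f_i^2$ of $f$ as a finite sum of squares of rational functions $f_i\in\mathbb{R}(x_1,\dots,x_n)$, the (reduced) denominator of some $f_i$ vanishes at $p$. Equivalently, $f$ is not a finite sum of squares in the local ring $\mathbb{R}[x_1,\dots,x_n]_{\mathfrak{m}_p}$, where $\mathfrak{m}_p\subset\mathbb{R}[x_1,\dots,x_n]$ is the maximal ideal of real polynomials vanishing at $p$. *)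

theory Defs
  imports
    "HOL-Analysis.Analysis"
    "HOL-Computational_Algebra.Computational_Algebra"
    "HOL-Computational_Algebra.Field_as_Ring"
begin

text \<open>
  The ring $R[x,y,z]$ is represented as the iterated polynomial ring $R[x][y][z]$ over the reals: the outermost polynomial variable
  is z and the innermost one is x. The rational function field $R(x,y,z)$ is the fraction
  field of this ring.
\<close>

type_synonym poly3 = "real poly poly poly"

type_synonym ratfun3 = "poly3 fract"

text \<open>
  The value of $f$ at the point $p = (x, y, z)$, where the coordinates lie in any commutative
  real algebra; it is used below for real and for complex points.
\<close>

definition eval3 :: "poly3 \<Rightarrow> ('a :: {real_algebra_1, comm_ring_1}) ^ 3 \<Rightarrow> 'a" where
  "eval3 f p =
     poly (map_poly (\<lambda>g. poly (map_poly (\<lambda>h. poly (map_poly of_real h) (p $ 1)) g) (p $ 2)) f) (p $ 3)"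

definition psd :: "poly3 \<Rightarrow> bool" where
  "psd f \<longleftrightarrow> (\<forall>a :: real ^ 3. eval3 f a \<ge> 0)"

text \<open>
  \<^const>\<open>quot_of_fract\<close> yields numerator and denominator of a fraction in lowest terms,
  the denominator being normalized by a real constant.
\<close>

definition reduced_denom :: "ratfun3 \<Rightarrow> poly3" where
  "reduced_denom r = snd (quot_of_fract r)"

text \<open>The notion is meant for positive semidefinite \<open>f\<close>; for other \<open>f\<close> it holds vacuously.\<close>

definition bad_point :: "poly3 \<Rightarrow> complex ^ 3 \<Rightarrow> bool" where
  "bad_point f p \<longleftrightarrow>
     (\<forall>rs :: ratfun3 list. to_fract f = (\<Sum>r\<leftarrow>rs. r ^ 2) \<longrightarrow>
        (\<exists>r \<in> set rs. eval3 (reduced_denom r) p = 0))"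

end

theory Submission
  imports Defs
begin

text \<open>
  Write \<open>s = x\<^sup>2 + 1\<close>, \<open>G = s\<^sup>3 - y\<^sup>2\<close>, and let \<open>C\<close> be the curve \<open>G = z = 0\<close>. Its real points form two
  smooth branches, parametrized by \<open>y = t\<^sup>3\<close>, where \<open>t\<^sup>2 = s\<close>, but at the non-real points \<open>(\<plusminus>\<i>, 0, 0)\<close> it has
  cusps, and there \<open>t = y / s\<close> is integral over the local ring of the curve without belonging to it.
  The polynomial is
  \<open>f = a G\<^sup>2 + 2 b G z + c z\<^sup>2 - z\<^sup>3 + 5 (G\<^sup>4 + z\<^sup>4)\<close>,
  where \<open>a = 2 s\<^sup>2 + y\<close>, \<open>b = s (2 y + s)\<close>, \<open>c = y (2 y + s)\<close>. On \<open>C\<close> these three coefficients are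
  \<open>\<alpha>\<close>, \<open>\<alpha> t\<close>, \<open>\<alpha> t\<^sup>2\<close> with \<open>\<alpha> = t\<^sup>3 (2 t + 1)\<close>, so that the leading form of \<open>f\<close> along \<open>C\<close> is
  the degenerate form \<open>\<alpha> (G + t z)\<^sup>2\<close>. As \<open>\<bar>t\<bar> \<ge> 1\<close> on the real points, \<open>\<alpha>\<close> is positive there.

  The point \<open>(\<i>, 0, 0)\<close> is bad (\<open>bad_point_bad_poly\<close>). Suppose that \<open>D\<^sup>2 f = \<Sum> g\<^sub>i\<^sup>2\<close> with polynomials \<open>D\<close>, \<open>g\<^sub>i\<close>.
  As \<open>f\<close> vanishes on the real points of \<open>C\<close>, so does each \<open>g\<^sub>i\<close>, whence \<open>g\<^sub>i = u\<^sub>i G + v\<^sub>i z + \<dots>\<close>.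
  As the leading form is degenerate, \<open>v\<^sub>i = t u\<^sub>i\<close> on \<open>C\<close>: both \<open>u\<^sub>i\<close> and \<open>t u\<^sub>i\<close> restrict to polynomials
  in \<open>x\<close> and \<open>y\<close>. Because of the cusp this forces \<open>u\<^sub>i\<close> to have order at least 2 in \<open>t\<close> at \<open>t = 0\<close>
  (\<open>remainder_if_multiple_by_t\<close>). Comparing \<open>G\<^sup>2\<close>-coefficients, \<open>\<Sum> u\<^sub>i\<^sup>2 = D\<^sup>2 \<alpha>\<close> on \<open>C\<close>. The left side has
  order at least 4, but \<open>\<alpha>\<close> has order 3, so \<open>D\<close> vanishes at the cusp (\<open>denominator_vanishes\<close>). The
  argument is carried out in \<open>\<real>[x]\<close>: modulo \<open>G\<close> every polynomial in \<open>x\<close>, \<open>y\<close> has the form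
  \<open>h\<^sub>0(x) + h\<^sub>1(x) y\<close>, and the order at the cusps is read off from divisibility by \<open>s\<close>.

  The polynomial \<open>f\<close> is nonnegative (\<open>psd_bad_poly\<close>) because the cubic part in \<open>(G, z)\<close> is chosen to
  match the degenerate leading form: near \<open>C\<close> the surface \<open>a G + b z = 0\<close> is where the quadratic part
  degenerates, and \<open>f\<close> must vanish to fourth order along it. The term \<open>- z\<^sup>3\<close>, together with the
  choice of \<open>c\<close> modulo \<open>G\<close>, achieves this. It is the reason for an \<open>\<alpha>\<close> of order 3: order 4 would not
  contradict a sum of squares, and order 2 would call for a cubic term with a coefficient like \<open>1 / t\<close>,
  which has a pole at the cusp. With \<open>r = sqrt s\<close>, \<open>y = r\<^sup>3 \<eta>\<close> and \<open>z = r\<^sup>5 \<zeta>\<close> the claim reduces to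
  an inequality in \<open>\<eta>\<close> and \<open>\<zeta>\<close> (\<open>two_var_ineq\<close>), where a square and the quartic terms outweigh the rest.
\<close>

section \<open>The polynomial and its cuspidal curve\<close>

definition xsq1 :: "real poly" where
  "xsq1 = [:1, 0, 1:]"

definition yvar :: "real poly poly" where
  "yvar = [:0, 1:]"

definition cusp :: "real poly poly" where
  "cusp = [:xsq1:] ^ 3 - yvar ^ 2"

text \<open>
  The coefficients of the leading form of the polynomial along the curve, in the basis
  \<open>G\<^sup>2\<close>, \<open>2 G z\<close>, \<open>z\<^sup>2\<close>. They are proportional to \<open>1, t, t\<^sup>2\<close> at \<open>y = t\<^sup>3\<close>, \<open>s = t\<^sup>2\<close>.
  Adding multiples of \<open>G\<close> would not change this; the representative \<open>2 y\<^sup>2\<close> of \<open>2 s\<^sup>3\<close> in \<open>form_zz\<close> is the one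
  for which the correction \<open>- z\<^sup>3\<close> suffices.
\<close>

definition form_GG :: "real poly poly" where
  "form_GG = 2 * [:xsq1:] ^ 2 + yvar"

definition form_Gz :: "real poly poly" where
  "form_Gz = [:xsq1:] * (2 * yvar + [:xsq1:])"

definition form_zz :: "real poly poly" where
  "form_zz = yvar * (2 * yvar + [:xsq1:])"

definition bad_poly :: poly3 where
  "bad_poly = [:form_GG * cusp ^ 2 + 5 * cusp ^ 4, 2 * form_Gz * cusp, form_zz, -1, 5:]"

abbreviation eval2 :: "real poly poly \<Rightarrow> real \<Rightarrow> real \<Rightarrow> real" where
  "eval2 h x y \<equiv> poly (poly h [:y:]) x"

lemma eval2_simps:
  "poly xsq1 x = x\<^sup>2 + 1"
  "eval2 cusp x y = (x\<^sup>2 + 1) ^ 3 - y\<^sup>2"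
  "eval2 form_GG x y = 2 * (x\<^sup>2 + 1)\<^sup>2 + y"
  "eval2 form_Gz x y = (x\<^sup>2 + 1) * (2 * y + (x\<^sup>2 + 1))"
  "eval2 form_zz x y = y * (2 * y + (x\<^sup>2 + 1))"
proof -
  show s: "poly xsq1 x = x\<^sup>2 + 1"
    by (simp add: xsq1_def power2_eq_square)
  show "eval2 cusp x y = (x\<^sup>2 + 1) ^ 3 - y\<^sup>2"
    "eval2 form_GG x y = 2 * (x\<^sup>2 + 1)\<^sup>2 + y"
    "eval2 form_Gz x y = (x\<^sup>2 + 1) * (2 * y + (x\<^sup>2 + 1))"
    "eval2 form_zz x y = y * (2 * y + (x\<^sup>2 + 1))"
    by (simp_all add: yvar_def cusp_def form_GG_def form_Gz_def form_zz_def s algebra_simps)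
qed

section \<open>Positive semidefiniteness\<close>

lemma map_poly_of_real_id: "map_poly of_real (h :: real poly) = h"
  by (simp add: map_poly_idI)

lemma eval2_eq_map_poly: "poly (map_poly (\<lambda>h. poly h x) g) y = eval2 g x y"
  by (induction g) (simp_all add: map_poly_pCons)

lemma eval3_real:
  fixes a :: "real ^ 3"
  shows "eval3 f a = poly (map_poly (\<lambda>g. eval2 g (a $ 1) (a $ 2)) f) (a $ 3)"
  by (simp add: eval3_def eval2_eq_map_poly map_poly_of_real_id)

text \<open>
  With \<open>w = \<gamma> + \<eta> \<zeta>\<close> the middle bracket equals
  \<open>\<eta> w\<^sup>2 + (2 \<gamma> - \<eta> \<zeta>) \<zeta> w - \<gamma> \<zeta>\<^sup>3\<close>. As long as \<open>2 + \<eta>\<close> stays away from 0, all of this is controlled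
  by \<open>w\<^sup>2\<close> and fourth powers. If \<open>\<bar>\<eta>\<bar>\<close> is large, then \<open>\<bar>\<eta>\<bar> \<le> \<gamma>\<^sup>2\<close> and \<open>1 \<le> \<gamma>\<^sup>2\<close>, and the fourth powers
  already dominate the bracket.
\<close>

lemma two_var_ineq:
  fixes \<eta> \<zeta> \<gamma> :: real
  assumes "\<gamma> = 1 - \<eta>\<^sup>2"
  shows "0 \<le> 2 * (\<gamma> + \<eta> * \<zeta>)\<^sup>2 + (\<eta> * (\<gamma>\<^sup>2 + \<zeta>\<^sup>2) + 2 * \<gamma> * \<zeta> - \<zeta> ^ 3)
             + 5 * (\<gamma> ^ 4 + \<zeta> ^ 4)"
proof -
  define w where "w = \<gamma> + \<eta> * \<zeta>"
  have sq: "0 \<le> (\<gamma>\<^sup>2 - \<zeta>\<^sup>2)\<^sup>2" "0 \<le> (\<gamma> * \<zeta> - \<zeta>\<^sup>2)\<^sup>2"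
    by simp_all
  have prod: "\<gamma>\<^sup>2 * \<zeta>\<^sup>2 \<le> (\<gamma> ^ 4 + \<zeta> ^ 4) / 2"
    using sq(1) by (simp add: power2_eq_square power4_eq_xxxx algebra_simps)
  show ?thesis
  proof (cases "\<bar>\<eta>\<bar> \<le> 3 / 2")
    case True
    have id: "\<eta> * (\<gamma>\<^sup>2 + \<zeta>\<^sup>2) + 2 * \<gamma> * \<zeta> - \<zeta> ^ 3
        = \<eta> * w\<^sup>2 + 2 * \<gamma> * \<zeta> * w - \<eta> * \<zeta>\<^sup>2 * w - \<gamma> * \<zeta> ^ 3"
      unfolding w_def assms by algebra
    have 1: "\<eta> * w\<^sup>2 \<ge> - (3 / 2) * w\<^sup>2"
      using True by (intro mult_right_mono) auto
    have 2: "2 * \<gamma> * \<zeta> * w \<ge> - (w\<^sup>2 / 4) - 4 * (\<gamma>\<^sup>2 * \<zeta>\<^sup>2)"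
    proof -
      have "0 \<le> (w / 2 + 2 * \<gamma> * \<zeta>)\<^sup>2" by simp
      then show ?thesis by (simp add: power2_eq_square algebra_simps)
    qed
    have "\<eta>\<^sup>2 \<le> 9 / 4"
      using power_mono[OF True, of 2] by (simp add: power2_eq_square)
    then have "\<eta>\<^sup>2 * \<zeta> ^ 4 \<le> 9 / 4 * \<zeta> ^ 4"
      by (intro mult_right_mono) auto
    moreover have "\<eta> * \<zeta>\<^sup>2 * w \<le> w\<^sup>2 / 4 + \<eta>\<^sup>2 * \<zeta> ^ 4"
    proof -
      have "0 \<le> (w / 2 - \<eta> * \<zeta>\<^sup>2)\<^sup>2" by simp
      then show ?thesis by (simp add: power2_eq_square power4_eq_xxxx algebra_simps)
    qed
    ultimately have 3: "\<eta> * \<zeta>\<^sup>2 * w \<le> w\<^sup>2 / 4 + 9 / 4 * \<zeta> ^ 4"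
      by linarith
    have 4: "\<gamma> * \<zeta> ^ 3 \<le> (\<gamma>\<^sup>2 * \<zeta>\<^sup>2 + \<zeta> ^ 4) / 2"
      using sq(2) by (simp add: power2_eq_square power3_eq_cube power4_eq_xxxx algebra_simps)
    have 5: "0 \<le> \<gamma> ^ 4" "0 \<le> \<zeta> ^ 4" by simp_all
    show ?thesis
      unfolding id w_def[symmetric] using 1 2 3 4 5 prod by argo
  next
    case False
    define h where "h = \<bar>\<eta>\<bar>"
    have h: "h \<ge> 3 / 2" and "\<eta>\<^sup>2 = h\<^sup>2"
      using False by (simp_all add: h_def)
    then have \<gamma>: "\<bar>\<gamma>\<bar> = h\<^sup>2 - 1"
      using assms mult_mono[OF h h] by (simp add: power2_eq_square)
    have "3 / 2 * h \<le> h\<^sup>2"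
      unfolding power2_eq_square using h by (intro mult_right_mono) auto
    then have "3 * h \<le> 2 * h\<^sup>2" "3 \<le> 2 * h"
      using h by simp_all
    then have "5 \<le> 4 * \<bar>\<gamma>\<bar>" "5 * h \<le> 6 * \<bar>\<gamma>\<bar>"
      unfolding \<gamma> right_diff_distrib by simp_all
    then have ge: "\<bar>\<gamma>\<bar> \<ge> 5 / 4" and h_le: "h \<le> 6 / 5 * \<bar>\<gamma>\<bar>"
      by simp_all
    have "5 / 4 * \<bar>\<gamma>\<bar> \<le> \<bar>\<gamma>\<bar> * \<bar>\<gamma>\<bar>"
      using ge by (intro mult_right_mono) auto
    then have h_sq: "h \<le> \<gamma>\<^sup>2" and one: "1 \<le> \<gamma>\<^sup>2"
      using h_le ge by (simp_all add: power2_eq_square)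
    have 1: "\<eta> * (\<gamma>\<^sup>2 + \<zeta>\<^sup>2) \<ge> - (\<gamma>\<^sup>2) * (\<gamma>\<^sup>2 + \<zeta>\<^sup>2)"
      using h_sq by (intro mult_right_mono) (auto simp: h_def)
    have 2: "1 * \<gamma>\<^sup>2 \<le> \<gamma>\<^sup>2 * \<gamma>\<^sup>2" "1 * \<zeta>\<^sup>2 \<le> \<gamma>\<^sup>2 * \<zeta>\<^sup>2"
      using one by (intro mult_right_mono; simp)+
    have 3: "2 * \<gamma> * \<zeta> \<ge> - (\<gamma>\<^sup>2) - \<zeta>\<^sup>2"
      using zero_le_power2[of "\<gamma> + \<zeta>"] by (simp add: power2_eq_square algebra_simps)
    have 4: "\<zeta> ^ 3 \<le> \<zeta>\<^sup>2 + \<zeta> ^ 4"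
    proof -
      have "0 \<le> (\<zeta> - \<zeta>\<^sup>2)\<^sup>2 + \<zeta>\<^sup>2 + \<zeta> ^ 4" by simp
      then show ?thesis
        by (simp add: power2_eq_square power3_eq_cube power4_eq_xxxx algebra_simps)
    qed
    have 5: "\<gamma>\<^sup>2 * \<gamma>\<^sup>2 = \<gamma> ^ 4" by simp
    have 6: "0 \<le> \<gamma> ^ 4" "0 \<le> \<zeta> ^ 4" "0 \<le> (\<gamma> + \<eta> * \<zeta>)\<^sup>2" by simp_all
    have 7: "- (\<gamma>\<^sup>2) * (\<gamma>\<^sup>2 + \<zeta>\<^sup>2) = - (\<gamma> ^ 4) - \<gamma>\<^sup>2 * \<zeta>\<^sup>2"
      by (simp add: algebra_simps)
    have "0 \<le> 2 * w2 + (e + k - c) + 5 * (g4 + z4)"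
      if "e \<ge> - g4 - m" "g2 \<le> g4" "z2 \<le> m" "k \<ge> - g2 - z2" "c \<le> z2 + z4"
        "0 \<le> g4" "0 \<le> z4" "0 \<le> w2" "m \<le> (g4 + z4) / 2" for w2 e k c g4 z4 m g2 z2 :: real
      using that by (simp add: field_simps)
    from this[OF 1[unfolded 7] 2[unfolded 5 mult_1] 3 4 6 prod] show ?thesis .
  qed
qed

text \<open>
  Give \<open>r = sqrt (x\<^sup>2 + 1)\<close>, \<open>y\<close>, \<open>z\<close> the weights 1, 3, 5. The terms of \<open>f\<close> then have weights 16 (the square
  \<open>2 (\<gamma> + \<eta> \<zeta>)\<^sup>2\<close>), 15, 24 and 20; since \<open>r \<ge> 1\<close>, the nonnegative ones among them may all be lowered
  to weight 15.
\<close>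

lemma psd_bad_poly: "psd bad_poly"
  unfolding psd_def
proof
  fix a :: "real ^ 3"
  define x y z where xyz: "x = a $ 1" "y = a $ 2" "z = a $ 3"
  define r where "r = sqrt (x\<^sup>2 + 1)"
  have r2: "x\<^sup>2 + 1 = r\<^sup>2" and r1: "r \<ge> 1"
    by (simp_all add: r_def)
  define \<eta> \<zeta> \<gamma> where "\<eta> = y / r ^ 3" and "\<zeta> = z / r ^ 5" and \<gamma>: "\<gamma> = 1 - \<eta>\<^sup>2"
  have y: "y = r ^ 3 * \<eta>" and z: "z = r ^ 5 * \<zeta>"
    using r1 by (simp_all add: \<eta>_def \<zeta>_def)
  define w B where "w = \<gamma> + \<eta> * \<zeta>"
    and "B = \<eta> * (\<gamma>\<^sup>2 + \<zeta>\<^sup>2) + 2 * \<gamma> * \<zeta> - \<zeta> ^ 3"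
  have "eval3 bad_poly a = (2 * (r\<^sup>2)\<^sup>2 + y) * ((r\<^sup>2) ^ 3 - y\<^sup>2)\<^sup>2 + 5 * ((r\<^sup>2) ^ 3 - y\<^sup>2) ^ 4
      + z * (2 * (r\<^sup>2 * (2 * y + r\<^sup>2)) * ((r\<^sup>2) ^ 3 - y\<^sup>2) + z * (y * (2 * y + r\<^sup>2) + z * (-1 + z * 5)))"
    by (simp add: eval3_real bad_poly_def map_poly_pCons eval2_simps xyz[symmetric] r2)
  also have "\<dots> = r ^ 16 * (2 * w\<^sup>2) + r ^ 15 * B + 5 * (r ^ 24 * \<gamma> ^ 4 + r ^ 20 * \<zeta> ^ 4)"
    unfolding y z w_def B_def \<gamma> by algebra
  also have "\<dots> \<ge> r ^ 15 * (2 * w\<^sup>2) + r ^ 15 * B + 5 * (r ^ 15 * \<gamma> ^ 4 + r ^ 15 * \<zeta> ^ 4)"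
    using r1 by (intro add_mono mult_left_mono mult_right_mono power_increasing) auto
  also have "r ^ 15 * (2 * w\<^sup>2) + r ^ 15 * B + 5 * (r ^ 15 * \<gamma> ^ 4 + r ^ 15 * \<zeta> ^ 4)
      = r ^ 15 * (2 * w\<^sup>2 + B + 5 * (\<gamma> ^ 4 + \<zeta> ^ 4))"
    by (simp add: algebra_simps)
  also have "\<dots> \<ge> 0"
    using two_var_ineq[OF \<gamma>, of \<zeta>] r1 unfolding w_def B_def
    by (intro mult_nonneg_nonneg) auto
  finally show "0 \<le> eval3 bad_poly a" .
qed

section \<open>Polynomials modulo the cuspidal curve\<close>

lemma cusp_remainder: "\<exists>q h0 h1. h = cusp * q + [:h0, h1:]"
proof (induction h)
  case 0
  show ?case by (intro exI[of _ 0]) simp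
next
  case (pCons c h)
  then obtain q h0 h1 where h: "h = cusp * q + [:h0, h1:]"
    by blast
  have "pCons c h = [:c:] + yvar * h"
    by (simp add: yvar_def)
  also have "\<dots> = cusp * (yvar * q - [:h1:]) + ([:c:] + yvar * [:h0:] + [:xsq1:] ^ 3 * [:h1:])"
  proof -
    have split: "[:h0, h1:] = [:h0:] + yvar * [:h1:]" by (simp add: yvar_def)
    have "c' + y * ((s ^ 3 - y ^ 2) * q + (a + y * b))
        = (s ^ 3 - y ^ 2) * (y * q - b) + (c' + y * a + s ^ 3 * b)"
      for c' y s a b :: "real poly poly"
      by (simp add: algebra_simps power2_eq_square)
    then show ?thesis
      unfolding h cusp_def split .
  qed
  also have "[:c:] + yvar * [:h0:] + [:xsq1:] ^ 3 * [:h1:] = [:c + xsq1 ^ 3 * h1, h0:]"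
    by (simp add: yvar_def power3_eq_cube)
  finally show ?case by blast
qed

lemma on_curve:
  assumes "t\<^sup>2 = x\<^sup>2 + 1"
  shows "eval2 cusp x (t ^ 3) = 0"
  unfolding eval2_simps assms[symmetric] by algebra

lemma poly_eqI_real:
  fixes p q :: "real poly"
  assumes "\<And>x. poly p x = poly q x"
  shows "p = q"
  using assms poly_eq_poly_eq_iff by blast

lemma curve_both_branches:
  fixes x :: real
  obtains r where "r > 0" "r\<^sup>2 = x\<^sup>2 + 1" "(- r)\<^sup>2 = x\<^sup>2 + 1"
proof
  show "sqrt (x\<^sup>2 + 1) > 0" using sum_power2_ge_zero[of x 0] by (simp add: add_nonneg_pos)
  show "(sqrt (x\<^sup>2 + 1))\<^sup>2 = x\<^sup>2 + 1" "(- sqrt (x\<^sup>2 + 1))\<^sup>2 = x\<^sup>2 + 1" by simp_all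
qed

text \<open>
  The real points of the curve determine the remainder: over each real \<open>x\<close> there are the two points
  \<open>y = \<plusminus> r\<^sup>3\<close>, and a linear polynomial in \<open>y\<close> with two zeros is 0.
\<close>

lemma cusp_dvd_if_vanishing:
  assumes "\<And>x t. t\<^sup>2 = x\<^sup>2 + 1 \<Longrightarrow> eval2 h x (t ^ 3) = 0"
  shows "cusp dvd h"
proof -
  obtain q h0 h1 where h: "h = cusp * q + [:h0, h1:]"
    using cusp_remainder by blast
  have "poly h0 x = 0 \<and> poly h1 x = 0" for x
  proof -
    obtain r where r: "r > 0" "r\<^sup>2 = x\<^sup>2 + 1" "(- r)\<^sup>2 = x\<^sup>2 + 1"
      by (rule curve_both_branches)
    have "poly h0 x + r ^ 3 * poly h1 x = 0" "poly h0 x - r ^ 3 * poly h1 x = 0"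
      using assms[OF r(2)] assms[OF r(3)] on_curve[OF r(2)] on_curve[OF r(3)]
      by (simp_all add: h)
    then show ?thesis using r(1) by simp
  qed
  then have "h0 = 0" "h1 = 0"
    by (auto intro!: poly_eqI_real)
  then show ?thesis by (simp add: h)
qed

text \<open>
  This is where the singularity enters: modulo the curve, the polynomials \<open>u\<close> for which \<open>t u\<close> is
  again a polynomial form the ideal generated by \<open>s\<close> and \<open>y\<close>, the conductor of the cusps. Indeed
  \<open>t (u\<^sub>0 + u\<^sub>1 t\<^sup>3) = t u\<^sub>0 + s\<^sup>2 u\<^sub>1\<close> can equal \<open>v\<^sub>0 + v\<^sub>1 t\<^sup>3 = v\<^sub>0 + t s v\<^sub>1\<close> for both signs of \<open>t\<close> only if
  \<open>u\<^sub>0 = s v\<^sub>1\<close>.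
\<close>

lemma remainder_if_multiple_by_t:
  assumes "\<And>x t. t\<^sup>2 = x\<^sup>2 + 1 \<Longrightarrow> eval2 v x (t ^ 3) = t * eval2 u x (t ^ 3)"
  shows "\<exists>q u0 u1. u = cusp * q + [:xsq1 * u0, u1:]"
proof -
  obtain q u0 u1 where u: "u = cusp * q + [:u0, u1:]"
    using cusp_remainder by blast
  obtain q' v0 v1 where v: "v = cusp * q' + [:v0, v1:]"
    using cusp_remainder by blast
  have "poly u0 x = poly (xsq1 * v1) x" for x
  proof -
    obtain r where r: "r > 0" "r\<^sup>2 = x\<^sup>2 + 1" "(- r)\<^sup>2 = x\<^sup>2 + 1"
      by (rule curve_both_branches)
    have "poly v0 x + r ^ 3 * poly v1 x = r * (poly u0 x + r ^ 3 * poly u1 x)"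
      "poly v0 x - r ^ 3 * poly v1 x = - r * (poly u0 x - r ^ 3 * poly u1 x)"
      using assms[OF r(2)] assms[OF r(3)] on_curve[OF r(2)] on_curve[OF r(3)]
      by (simp_all add: u v)
    then have "r * (poly u0 x - r\<^sup>2 * poly v1 x) = 0"
      by algebra
    then show ?thesis using r by (simp add: eval2_simps)
  qed
  then have "u0 = xsq1 * v1" by (rule poly_eqI_real)
  with u show ?thesis by blast
qed

section \<open>Denominators in sums of squares with a given leading form along the curve\<close>

lemma coeff_square:
  fixes g :: "'a :: comm_semiring_1 poly"
  shows "coeff (g ^ 2) 0 = coeff g 0 ^ 2"
    "coeff (g ^ 2) 1 = 2 * coeff g 0 * coeff g 1"
    "coeff (g ^ 2) 2 = coeff g 1 ^ 2 + 2 * coeff g 0 * coeff g 2"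
proof -
  show "coeff (g ^ 2) 0 = coeff g 0 ^ 2" "coeff (g ^ 2) 1 = 2 * coeff g 0 * coeff g 1"
    by (simp_all add: power2_eq_square coeff_mult atMost_Suc algebra_simps mult_2)
  have "coeff (g ^ 2) 2 = coeff g 0 * coeff g 2 + coeff g 1 * coeff g 1 + coeff g 2 * coeff g 0"
    by (simp add: power2_eq_square coeff_mult atMost_Suc numeral_2_eq_2 algebra_simps)
  then show "coeff (g ^ 2) 2 = coeff g 1 ^ 2 + 2 * coeff g 0 * coeff g 2"
    by (simp add: power2_eq_square algebra_simps mult_2)
qed

text \<open>
  Only the leading form of \<open>f\<close> along the curve matters. The coefficients of \<open>z\<^sup>0\<close>, \<open>z\<^sup>1\<close>, \<open>z\<^sup>2\<close> in
  \<open>D\<^sup>2 f = \<Sum> g\<^sub>i\<^sup>2\<close> express \<open>\<Sum> u\<^sub>i\<^sup>2\<close>, \<open>\<Sum> u\<^sub>i v\<^sub>i\<close>, \<open>\<Sum> v\<^sub>i\<^sup>2\<close> on the curve, so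
  \<open>\<Sum> (v\<^sub>i - t u\<^sub>i)\<^sup>2 = 0\<close> at its real points. Hence \<open>u\<^sub>i = s a\<^sub>i + b\<^sub>i y\<close> on the curve, and the part of
  \<open>\<Sum> u\<^sub>i\<^sup>2 = (d\<^sub>0 + d\<^sub>1 y)\<^sup>2 (2 s\<^sup>2 + y)\<close> that is odd in \<open>y\<close> reads
  \<open>2 s \<Sum> a\<^sub>i b\<^sub>i = d\<^sub>0\<^sup>2 + s\<^sup>3 d\<^sub>1\<^sup>2 + 4 s\<^sup>2 d\<^sub>0 d\<^sub>1\<close>, which gives \<open>s dvd d\<^sub>0\<^sup>2\<close>.
\<close>

lemma denominator_vanishes:
  fixes D f :: poly3 and g :: "'i \<Rightarrow> poly3"
  assumes fin: "finite I" and eq: "D ^ 2 * f = (\<Sum>i\<in>I. g i ^ 2)"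
    and f0: "coeff f 0 = cusp ^ 2 * (form_GG + cusp * e0)"
    and f1: "coeff f 1 = cusp * (2 * form_Gz + cusp * e1)"
    and f2: "coeff f 2 = form_zz + cusp * e2"
  shows "xsq1 dvd coeff (coeff D 0) 0 ^ 2"
proof -
  define d where "d = coeff D 0"
  define d' where "d' = coeff (D ^ 2) 1"
  define d'' where "d'' = coeff (D ^ 2) 2"
  define v where "v i = coeff (g i) 1" for i
  have c0: "(\<Sum>i\<in>I. coeff (g i) 0 ^ 2) = d ^ 2 * coeff f 0"
  proof -
    have "(\<Sum>i\<in>I. coeff (g i) 0 ^ 2) = coeff (\<Sum>i\<in>I. g i ^ 2) 0"
      by (simp only: coeff_sum coeff_square)
    also have "\<dots> = d ^ 2 * coeff f 0"
      by (simp add: eq[symmetric] coeff_mult_0 coeff_square d_def)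
    finally show ?thesis .
  qed
  have c1: "(\<Sum>i\<in>I. 2 * coeff (g i) 0 * v i) = d ^ 2 * coeff f 1 + d' * coeff f 0"
  proof -
    have "(\<Sum>i\<in>I. 2 * coeff (g i) 0 * v i) = coeff (\<Sum>i\<in>I. g i ^ 2) 1"
      by (simp only: coeff_sum coeff_square v_def)
    also have "\<dots> = coeff (D ^ 2) 0 * coeff f 1 + coeff (D ^ 2) 1 * coeff f 0"
      unfolding eq[symmetric] coeff_mult[of "D ^ 2"] by (simp add: atMost_Suc)
    finally show ?thesis by (simp only: coeff_square d_def d'_def)
  qed
  have c2: "(\<Sum>i\<in>I. v i ^ 2 + 2 * coeff (g i) 0 * coeff (g i) 2)
      = d ^ 2 * coeff f 2 + d' * coeff f 1 + d'' * coeff f 0"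
  proof -
    have "(\<Sum>i\<in>I. v i ^ 2 + 2 * coeff (g i) 0 * coeff (g i) 2) = coeff (\<Sum>i\<in>I. g i ^ 2) 2"
      by (simp only: coeff_sum coeff_square v_def)
    also have "\<dots> = coeff (D ^ 2) 0 * coeff f 2 + coeff (D ^ 2) 1 * coeff f 1
        + coeff (D ^ 2) 2 * coeff f 0"
      unfolding eq[symmetric] coeff_mult[of "D ^ 2"]
      by (simp add: atMost_Suc numeral_2_eq_2)
    finally show ?thesis by (simp only: coeff_square d_def d'_def d''_def)
  qed
  have "cusp dvd coeff (g i) 0" if i: "i \<in> I" for i
  proof (rule cusp_dvd_if_vanishing)
    fix x t :: real assume t: "t\<^sup>2 = x\<^sup>2 + 1"
    have "(\<Sum>i\<in>I. (eval2 (coeff (g i) 0) x (t ^ 3))\<^sup>2) = eval2 (\<Sum>i\<in>I. coeff (g i) 0 ^ 2) x (t ^ 3)"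
      by (simp add: poly_sum)
    also have "\<dots> = 0"
      by (simp add: c0 f0 on_curve[OF t])
    finally show "eval2 (coeff (g i) 0) x (t ^ 3) = 0"
      using fin i by (simp add: sum_nonneg_eq_0_iff)
  qed
  then obtain u where u: "\<And>i. i \<in> I \<Longrightarrow> coeff (g i) 0 = cusp * u i"
    unfolding dvd_def by metis
  have cusp_nz: "cusp \<noteq> 0"
  proof
    assume "cusp = 0"
    then have "eval2 cusp 0 0 = 0" by simp
    then show False unfolding eval2_simps by simp
  qed
  have uu: "(\<Sum>i\<in>I. u i ^ 2) = d ^ 2 * (form_GG + cusp * e0)"
  proof -
    have "cusp ^ 2 * (\<Sum>i\<in>I. u i ^ 2) = (\<Sum>i\<in>I. coeff (g i) 0 ^ 2)"
      by (simp add: u sum_distrib_left power_mult_distrib)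
    also have "\<dots> = cusp ^ 2 * (d ^ 2 * (form_GG + cusp * e0))"
      unfolding c0 f0 by (simp add: algebra_simps)
    finally show ?thesis using cusp_nz by simp
  qed
  have uv: "2 * (\<Sum>i\<in>I. u i * v i) = 2 * d ^ 2 * form_Gz + cusp * (d ^ 2 * e1 + d' * (form_GG + cusp * e0))"
  proof -
    have "cusp * (2 * (\<Sum>i\<in>I. u i * v i)) = (\<Sum>i\<in>I. 2 * coeff (g i) 0 * v i)"
      by (simp add: u sum_distrib_left mult.assoc mult.left_commute)
    also have "\<dots> = cusp * (2 * d ^ 2 * form_Gz + cusp * (d ^ 2 * e1 + d' * (form_GG + cusp * e0)))"
      unfolding c1 f0 f1 by algebra
    finally show ?thesis using cusp_nz by simp
  qed
  have "\<exists>q a b. u i = cusp * q + [:xsq1 * a, b:]" if i: "i \<in> I" for i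
  proof (rule remainder_if_multiple_by_t)
    fix x t :: real assume t: "t\<^sup>2 = x\<^sup>2 + 1"
    let ?val = "\<lambda>h. eval2 h x (t ^ 3)"
    note zero = on_curve[OF t]
    have uu': "(\<Sum>i\<in>I. (?val (u i))\<^sup>2) = (?val d)\<^sup>2 * ?val form_GG"
      using arg_cong[OF uu, of ?val] by (simp add: poly_sum zero)
    have uv': "(\<Sum>i\<in>I. ?val (u i) * ?val (v i)) = (?val d)\<^sup>2 * ?val form_Gz"
      using arg_cong[OF uv, of ?val] by (simp add: poly_sum zero)
    have vv': "(\<Sum>i\<in>I. (?val (v i))\<^sup>2) = (?val d)\<^sup>2 * ?val form_zz"
    proof -
      have "(\<Sum>i\<in>I. (?val (v i))\<^sup>2) = ?val (\<Sum>i\<in>I. v i ^ 2 + 2 * coeff (g i) 0 * coeff (g i) 2)"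
        by (simp add: poly_sum u zero)
      also have "\<dots> = (?val d)\<^sup>2 * ?val form_zz"
        unfolding c2 f0 f1 f2 by (simp add: zero)
      finally show ?thesis .
    qed
    have "(\<Sum>i\<in>I. (?val (v i) - t * ?val (u i))\<^sup>2)
        = (\<Sum>i\<in>I. (?val (v i))\<^sup>2) - 2 * t * (\<Sum>i\<in>I. ?val (u i) * ?val (v i))
          + t\<^sup>2 * (\<Sum>i\<in>I. (?val (u i))\<^sup>2)"
      by (simp add: sum_distrib_left sum_subtractf[symmetric] sum.distrib[symmetric]
          power2_eq_square algebra_simps)
    also have "\<dots> = (?val d)\<^sup>2 * (?val form_zz - 2 * t * ?val form_Gz + t\<^sup>2 * ?val form_GG)"
      unfolding uu' uv' vv' by (simp add: algebra_simps)
    \<comment> \<open>The leading form vanishes in the direction \<open>(G, z) = (- t, 1)\<close>.\<close>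
    also have "?val form_zz - 2 * t * ?val form_Gz + t\<^sup>2 * ?val form_GG = 0"
      unfolding eval2_simps t[symmetric] by algebra
    finally show "?val (v i) = t * ?val (u i)"
      using fin i by (simp add: sum_nonneg_eq_0_iff)
  qed
  then obtain q a b where qab: "\<And>i. i \<in> I \<Longrightarrow> u i = cusp * q i + [:xsq1 * a i, b i:]"
    by metis
  obtain dq d0 d1 where d: "d = cusp * dq + [:d0, d1:]"
    using cusp_remainder by blast
  have "poly (d0 ^ 2) x = poly (xsq1 * (2 * (\<Sum>i\<in>I. a i * b i) - 4 * xsq1 * d0 * d1 - xsq1 ^ 2 * d1 ^ 2)) x"
    for x
  proof -
    obtain r where r: "r > 0" "r\<^sup>2 = x\<^sup>2 + 1" "(- r)\<^sup>2 = x\<^sup>2 + 1"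
      by (rule curve_both_branches)
    have branch: "(\<Sum>i\<in>I. (t\<^sup>2 * poly (a i) x + t ^ 3 * poly (b i) x)\<^sup>2)
        = (poly d0 x + t ^ 3 * poly d1 x)\<^sup>2 * (2 * (t\<^sup>2)\<^sup>2 + t ^ 3)" if t: "t\<^sup>2 = x\<^sup>2 + 1" for t
    proof -
      have "(\<Sum>i\<in>I. (t\<^sup>2 * poly (a i) x + t ^ 3 * poly (b i) x)\<^sup>2)
          = (\<Sum>i\<in>I. (eval2 (u i) x (t ^ 3))\<^sup>2)"
        by (rule sum.cong[OF refl])
          (simp add: qab on_curve[OF t] eval2_simps(1) t[symmetric])
      also have "\<dots> = eval2 (\<Sum>i\<in>I. u i ^ 2) x (t ^ 3)"
        by (simp add: poly_sum)
      also have "\<dots> = (poly d0 x + t ^ 3 * poly d1 x)\<^sup>2 * (2 * (t\<^sup>2)\<^sup>2 + t ^ 3)"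
        by (simp add: uu d on_curve[OF t] eval2_simps(3) t[symmetric])
      finally show ?thesis .
    qed
    \<comment> \<open>Subtracting the two branches isolates the part that is odd in \<open>y\<close>.\<close>
    have "(\<Sum>i\<in>I. (r\<^sup>2 * poly (a i) x + r ^ 3 * poly (b i) x)\<^sup>2)
        - (\<Sum>i\<in>I. ((- r)\<^sup>2 * poly (a i) x + (- r) ^ 3 * poly (b i) x)\<^sup>2)
        = (\<Sum>i\<in>I. 4 * r ^ 5 * (poly (a i) x * poly (b i) x))"
      unfolding sum_subtractf[symmetric] by (intro sum.cong refl) algebra
    also have "\<dots> = 4 * r ^ 5 * (\<Sum>i\<in>I. poly (a i) x * poly (b i) x)"
      by (simp add: sum_distrib_left)
    finally have "2 * r ^ 3 * (poly d0 x)\<^sup>2 = 2 * r ^ 3 * (r\<^sup>2 * (2 * (\<Sum>i\<in>I. poly (a i) x * poly (b i) x)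
        - 4 * r\<^sup>2 * poly d0 x * poly d1 x - (r\<^sup>2)\<^sup>2 * (poly d1 x)\<^sup>2))"
      unfolding branch[OF r(2)] branch[OF r(3)] by algebra
    then have "(poly d0 x)\<^sup>2 = r\<^sup>2 * (2 * (\<Sum>i\<in>I. poly (a i) x * poly (b i) x)
        - 4 * r\<^sup>2 * poly d0 x * poly d1 x - (r\<^sup>2)\<^sup>2 * (poly d1 x)\<^sup>2)"
      using r(1) by simp
    then show ?thesis by (simp add: r eval2_simps poly_sum)
  qed
  from poly_eqI_real[OF this] have dvd_d0: "xsq1 dvd d0 ^ 2"
    by (rule dvdI)
  \<comment> \<open>At the cusps \<open>y = 0\<close>, and there \<open>d\<close> agrees with its remainder modulo \<open>s\<close>.\<close>
  have "coeff d 0 = xsq1 * (xsq1 ^ 2 * coeff dq 0) + d0"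
    by (simp add: d cusp_def yvar_def coeff_mult_0 power2_eq_square power3_eq_cube mult.assoc)
  moreover have "(k * e + h) ^ 2 = k * (e * (k * e + 2 * h)) + h ^ 2" for k e h :: "real poly"
    by algebra
  ultimately have "coeff d 0 ^ 2
      = xsq1 * ((xsq1 ^ 2 * coeff dq 0) * (xsq1 * (xsq1 ^ 2 * coeff dq 0) + 2 * d0)) + d0 ^ 2"
    by (simp only:)
  then show ?thesis
    unfolding d_def[symmetric] using dvd_add[OF dvd_triv_left dvd_d0] by (simp only:)
qed

section \<open>The bad point\<close>

abbreviation cusp_point :: "complex ^ 3" where
  "cusp_point \<equiv> vector [\<i>, 0, 0]"

lemma eval3_cusp_point: "eval3 h cusp_point = poly (map_poly of_real (coeff (coeff h 0) 0)) \<i>"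
  by (simp add: eval3_def poly_0_coeff_0 coeff_map_poly)

lemma poly_map_of_real_mult:
  fixes p q :: "real poly"
  shows "poly (map_poly of_real (p * q)) z = poly (map_poly of_real p) z * poly (map_poly of_real q) (z :: complex)"
proof (induction p)
  case (pCons c p)
  have add: "map_poly of_real (r + r') = map_poly of_real r + (map_poly of_real r' :: complex poly)"
    for r r' :: "real poly"
    by (intro poly_eqI) (simp add: coeff_map_poly)
  have "map_poly of_real (smult c q) = smult (of_real c) (map_poly of_real q :: complex poly)"
    by (intro poly_eqI) (simp add: coeff_map_poly)
  with pCons show ?case by (simp add: map_poly_pCons add algebra_simps)
qed simp

lemma eval3_cusp_point_mult: "eval3 (h * h') cusp_point = eval3 h cusp_point * eval3 h' cusp_point"
  by (simp add: eval3_cusp_point coeff_mult_0 poly_map_of_real_mult)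

lemma to_fract_numerator:
  "\<exists>n. r * to_fract (reduced_denom r) = to_fract n"
proof -
  let ?n = "fst (quot_of_fract r)" and ?d = "snd (quot_of_fract r)"
  have "Fraction_Field.Fract ?n ?d * to_fract ?d = to_fract ?n"
    by (simp add: to_fract_def eq_fract del: Fract_quot_of_fract)
  then have "r * to_fract ?d = to_fract ?n" by simp
  then show ?thesis unfolding reduced_denom_def by blast
qed

lemma clear_denominators:
  assumes "\<forall>r \<in> set rs. eval3 (reduced_denom r) cusp_point \<noteq> 0"
  shows "\<exists>D gs. eval3 D cusp_point \<noteq> 0 \<and>
    to_fract D ^ 2 * (\<Sum>r\<leftarrow>rs. r ^ 2) = to_fract (\<Sum>g\<leftarrow>gs. g ^ 2)"
  using assms
proof (induction rs)
  case Nil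
  show ?case
    by (intro exI[of _ 1] exI[of _ "[]"]) (simp add: eval3_cusp_point)
next
  case (Cons r rs)
  then obtain D gs where D: "eval3 D cusp_point \<noteq> 0"
    "to_fract D ^ 2 * (\<Sum>r\<leftarrow>rs. r ^ 2) = to_fract (\<Sum>g\<leftarrow>gs. g ^ 2)"
    by auto
  obtain n where n: "r * to_fract (reduced_denom r) = to_fract n"
    using to_fract_numerator by blast
  let ?d = "reduced_denom r"
  let ?gs = "D * n # map ((*) ?d) gs"
  have sq: "(\<Sum>g\<leftarrow>map ((*) ?d) gs. g ^ 2) = ?d ^ 2 * (\<Sum>g\<leftarrow>gs. g ^ 2)"
    by (induction gs) (simp_all add: algebra_simps power_mult_distrib)
  have pow: "to_fract (h ^ 2) = to_fract h ^ 2" for h :: poly3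
    by (simp add: power2_eq_square)
  have "to_fract (D * ?d) ^ 2 * (\<Sum>r\<leftarrow>r # rs. r ^ 2)
      = to_fract D ^ 2 * (r * to_fract ?d) ^ 2 + to_fract ?d ^ 2 * (to_fract D ^ 2 * (\<Sum>r\<leftarrow>rs. r ^ 2))"
    by (simp add: algebra_simps power_mult_distrib)
  also have "\<dots> = to_fract (\<Sum>g\<leftarrow>?gs. g ^ 2)"
    unfolding n D(2) list.map sum_list.Cons sq
    by (simp add: pow power_mult_distrib)
  finally have "to_fract (D * ?d) ^ 2 * (\<Sum>r\<leftarrow>r # rs. r ^ 2) = to_fract (\<Sum>g\<leftarrow>?gs. g ^ 2)" .
  moreover have "eval3 (D * ?d) cusp_point \<noteq> 0"
    using D(1) Cons.prems by (simp add: eval3_cusp_point_mult)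
  ultimately show ?case by blast
qed

lemma bad_point_bad_poly: "bad_point bad_poly cusp_point"
  unfolding bad_point_def
proof (intro allI impI)
  fix rs :: "ratfun3 list"
  assume sos: "to_fract bad_poly = (\<Sum>r\<leftarrow>rs. r ^ 2)"
  show "\<exists>r \<in> set rs. eval3 (reduced_denom r) cusp_point = 0"
  proof (rule ccontr)
    assume "\<not> ?thesis"
    then obtain D gs where D: "eval3 D cusp_point \<noteq> 0"
      "to_fract D ^ 2 * to_fract bad_poly = to_fract (\<Sum>g\<leftarrow>gs. g ^ 2)"
      using clear_denominators[of rs] sos by auto
    then have "to_fract (D ^ 2 * bad_poly) = to_fract (\<Sum>g\<leftarrow>gs. g ^ 2)"
      by (simp add: power2_eq_square)
    then have "D ^ 2 * bad_poly = (\<Sum>g\<leftarrow>gs. g ^ 2)"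
      by (simp only: to_fract_eq_iff)
    also have "\<dots> = (\<Sum>i<length gs. (gs ! i) ^ 2)"
      by (simp add: sum_list_sum_nth atLeast0LessThan)
    finally have "xsq1 dvd coeff (coeff D 0) 0 ^ 2"
      by (rule denominator_vanishes[where ?e0.0 = "5 * cusp" and ?e1.0 = 0 and ?e2.0 = 0, rotated])
        (simp_all add: bad_poly_def algebra_simps power2_eq_square power4_eq_xxxx numeral_2_eq_2)
    then obtain k where "coeff (coeff D 0) 0 ^ 2 = xsq1 * k" ..
    moreover have "poly (map_poly of_real xsq1) \<i> = 0"
      by (simp add: xsq1_def map_poly_pCons)
    ultimately have "eval3 D cusp_point ^ 2 = 0"
      by (metis eval3_cusp_point poly_map_of_real_mult power2_eq_square mult_zero_left)
    with D(1) show False by simp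
  qed
qed

theorem theorem0p2:
  shows "\<exists>(f :: poly3) (p :: complex ^ 3).
           psd f \<and> bad_point f p \<and> p \<notin> {q. \<forall>i. q $ i \<in> \<real>}"
proof (intro exI conjI)
  show "psd bad_poly" by (rule psd_bad_poly)
  show "bad_point bad_poly cusp_point" by (rule bad_point_bad_poly)
  have "cusp_point $ 1 \<notin> \<real>" by (simp add: complex_is_Real_iff)
  then show "cusp_point \<notin> {q. \<forall>i. q $ i \<in> \<real>}" by blast
qed

end
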